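(* Let $\alpha\in\mathbb C$, let $r\ge0$ be an integer, put $q:=r-1-\alpha$, and let $F\in\mathbb C[[z]]$ be Möbius-covariant of weight $\alpha$. For $h\in\mathbb C[[z]]$ define $$L_{r,F}(h):=[z^r]\,h(z)F(z),\qquad (\mathscr T_qh)(z):=(1-z)^q\,h\!\left(-\frac{z}{1-z}\right).$$ Then for every $h\in\mathbb C[[z]]$ one has $$L_{r,F}(h)=(-1)^rL_{r,F}(\mathscr T_qh),$$ and $\mathscr T_q^2=1$ (the identity operator on $\mathbb C[[z]]$).
   Context: $[z^r]H(z)$ denotes the coefficient of $z^r$ in the formal power series $H(z)$. For $\beta\in\mathbb C$, $(1-z)^\beta:=\sum_{k\ge0}\binom{\beta}{k}(-z)^k$. A series $F\in\mathbb C[[z]]$ is Möbius-covariant of weight $\alpha$ if $F\!\left(-\frac{z}{1-z}\right)=(1-z)^{-\alpha}F(z)$ in $\mathbb C[[z]]$. *)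

theory Defs
  imports "HOL-Computational_Algebra.Formal_Power_Series"
begin

definition one_minus_pow :: "complex \<Rightarrow> complex fps" where
  "one_minus_pow \<beta> = Abs_fps (\<lambda>k. (\<beta> gchoose k) * (- 1) ^ k)"

text \<open>The divisor has constant coefficient 1, so this is genuine division of power series, and
  the quotient has constant coefficient 0, so \<open>fps_compose h moebius_arg\<close> is genuine
  substitution.\<close>

definition moebius_arg :: "complex fps" where
  "moebius_arg = - (fps_X / (1 - fps_X))"

definition moebius_covariant :: "complex \<Rightarrow> complex fps \<Rightarrow> bool" where
  "moebius_covariant \<alpha> F \<longleftrightarrow> fps_compose F moebius_arg = one_minus_pow (- \<alpha>) * F"

definition coeff_functional :: "nat \<Rightarrow> complex fps \<Rightarrow> complex fps \<Rightarrow> complex" where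
  "coeff_functional r F h = fps_nth (h * F) r"

definition moebius_op :: "complex \<Rightarrow> complex fps \<Rightarrow> complex fps" where
  "moebius_op q h = one_minus_pow q * fps_compose h moebius_arg"

end

theory Submission
  imports Defs
begin

unbundle fps_syntax

text \<open>
  Substituting \<open>m = -z/(1 - z)\<close> gives \<open>(1 - m)^q = (1 - z)^(-q)\<close> and \<open>m \<circ> m = z\<close>, whence
  \<open>\<T>\<^sub>q\<close> is an involution. For the functional, covariance turns \<open>(\<T>\<^sub>q h) F\<close> into
  \<open>(1 - z)^(r-1) (h F)(m)\<close>. The \<open>k\<close>-th term of \<open>h F\<close> contributes to the coefficient of \<open>z^r\<close> a
  multiple of \<open>[z^(r-k)] (1 - z)^(r-1-k)\<close>, which vanishes for \<open>k < r\<close> because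
  \<open>(1 - z)^(r-1-k)\<close> is then a polynomial of degree \<open>r - 1 - k\<close>.
\<close>

text \<open>Makes the theory of \<open>fps_binomial\<close> available for (1 - z)^\<beta>, above all
  the exponent law.\<close>

lemma one_minus_pow_altdef: "one_minus_pow \<beta> = fps_binomial \<beta> oo (- fps_X)"
  by (rule fps_ext) (simp add: one_minus_pow_def fps_compose_uminus')

lemma one_minus_pow_0 [simp]: "one_minus_pow 0 = 1"
  by (simp add: one_minus_pow_altdef)

lemma one_minus_pow_add: "one_minus_pow (a + b) = one_minus_pow a * one_minus_pow b"
  by (simp add: one_minus_pow_altdef fps_binomial_add_mult fps_compose_mult_distrib)

lemma one_minus_pow_power: "one_minus_pow a ^ n = one_minus_pow (of_nat n * a)"
  by (induction n) (simp_all add: ring_distribs flip: one_minus_pow_add)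

lemma one_minus_pow_uminus_mult [simp]: "one_minus_pow (- a) * one_minus_pow a = 1"
  by (simp flip: one_minus_pow_add)

lemma one_minus_pow_minus_1: "one_minus_pow (- 1) = inverse (1 - fps_X)"
  by (simp add: one_minus_pow_altdef fps_binomial_minus_one fps_inverse_compose
        fps_compose_add_distrib)

lemma moebius_arg_altdef: "moebius_arg = - (fps_X * one_minus_pow (- 1))"
  by (simp add: moebius_arg_def one_minus_pow_minus_1 fps_divide_unit)

lemma moebius_arg_nth_0 [simp]: "moebius_arg $ 0 = 0"
  by (simp add: moebius_arg_altdef)

lemma moebius_arg_power:
  "moebius_arg ^ k = fps_const ((- 1) ^ k) * (fps_X ^ k * one_minus_pow (- of_nat k))"
proof -
  have eq: "moebius_arg = fps_const (- 1) * (fps_X * one_minus_pow (- 1))"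
    by (simp add: moebius_arg_altdef flip: fps_const_neg)
  show ?thesis
    unfolding eq power_mult_distrib one_minus_pow_power fps_const_power by simp
qed

text \<open>With w = -z/(1 + z) one has 1 + w = 1/(1 + z), so this is (1 + w)^c = (1 + z)^(-c). As c
  is an arbitrary complex number, the proof goes through the differential equation (1 + z) A' = -c
  A.\<close>

lemma fps_binomial_compose_inverse:
  "fps_binomial (c :: complex) oo (- fps_X * inverse (1 + fps_X)) = fps_binomial (- c)"
proof -
  define u :: "complex fps" where "u = 1 + fps_X"
  define w where "w = - fps_X * inverse u"
  define A where "A = fps_binomial c oo w"
  have u0: "u $ 0 \<noteq> 0" and w0: "w $ 0 = 0"
    by (simp_all add: u_def w_def)
  have u: "u * inverse u = 1"
    using u0 by (simp add: inverse_mult_eq_1')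
  have X: "fps_X = u - 1"
    by (simp add: u_def)
  have w: "w = inverse u - 1"
    using u by (simp add: w_def X algebra_simps)
  have dw: "fps_deriv w = - (inverse u * inverse u)"
    using u0 by (simp add: w fps_inverse_deriv power2_eq_square) (simp add: u_def)
  have comp: "inverse (1 + fps_X) oo w = u"
    using u0 w0
    by (simp add: fps_inverse_compose fps_compose_add_distrib)
      (simp add: w fps_inverse_idempotent)
  have "fps_deriv A = (fps_deriv (fps_binomial c) oo w) * fps_deriv w"
    unfolding A_def by (rule fps_compose_deriv[OF w0])
  also have "fps_deriv (fps_binomial c) oo w = fps_const c * A * u"
    using w0 comp
    by (simp add: fps_binomial_deriv fps_divide_unit fps_compose_mult_distrib A_def)
  also have "fps_const c * A * u * fps_deriv w = - (fps_const c * A * inverse u * (u * inverse u))"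
    by (simp only: dw) (simp add: mult_ac)
  also have "\<dots> = fps_const (- c) * A / (1 + fps_X)"
    by (simp add: u) (simp add: u_def fps_divide_unit flip: fps_const_neg)
  \<comment> \<open>The equation determines A up to its constant coefficient, which is 1 because w
    has none.\<close>
  finally have "A = fps_const (A $ 0) * fps_binomial (- c)"
    by (simp add: fps_binomial_ODE_unique)
  thus ?thesis
    by (simp add: A_def w_def u_def)
qed

text \<open>Conjugation by z -> -z reduces this to the previous lemma: -m = z/(1 - z) is -z/(1 + z)
  evaluated at -z.\<close>

lemma one_minus_pow_compose_moebius_arg: "one_minus_pow q oo moebius_arg = one_minus_pow (- q)"
proof -
  have "one_minus_pow q oo moebius_arg = fps_binomial q oo (- fps_X oo moebius_arg)"
    by (simp add: one_minus_pow_altdef fps_compose_assoc)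
  also have "- fps_X oo moebius_arg = (- fps_X * inverse (1 + fps_X)) oo (- fps_X)"
    by (simp add: fps_compose_uminus moebius_arg_altdef one_minus_pow_minus_1
          fps_compose_mult_distrib fps_inverse_compose fps_compose_add_distrib)
  also have "fps_binomial q oo \<dots> = (fps_binomial q oo (- fps_X * inverse (1 + fps_X))) oo (- fps_X)"
    by (rule fps_compose_assoc) simp_all
  finally show ?thesis
    by (simp only: fps_binomial_compose_inverse one_minus_pow_altdef)
qed

text \<open>Since (1 - m)^(-1) = 1 - z, one gets m(m) = -m (1 - z) = z.\<close>

lemma moebius_arg_compose_moebius_arg: "moebius_arg oo moebius_arg = fps_X"
proof -
  have "moebius_arg oo moebius_arg = - (moebius_arg * one_minus_pow 1)"
    by (subst (1) moebius_arg_altdef)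
      (simp add: fps_compose_uminus fps_compose_mult_distrib one_minus_pow_compose_moebius_arg)
  thus ?thesis
    by (simp add: moebius_arg_altdef mult.assoc)
qed

lemma moebius_op_involution: "moebius_op q (moebius_op q h) = h"
proof -
  have "moebius_op q (moebius_op q h) =
      one_minus_pow q * one_minus_pow (- q) * (h oo (moebius_arg oo moebius_arg))"
    by (simp add: moebius_op_def fps_compose_mult_distrib one_minus_pow_compose_moebius_arg
          fps_compose_assoc mult.assoc)
  thus ?thesis
    by (simp add: moebius_arg_compose_moebius_arg flip: one_minus_pow_add)
qed

lemma fps_mult_compose_nth:
  fixes b g m :: "'a :: comm_ring_1 fps"
  assumes "m $ 0 = 0"
  shows "(b * (g oo m)) $ r = (\<Sum>k=0..r. g $ k * (b * m ^ k) $ r)"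
proof -
  \<comment> \<open>The power m^k has no terms below degree k, so the sum may run up to r for every
    i; this uniform range permits the swap of sums.\<close>
  have "(g oo m) $ (r - i) = (\<Sum>k=0..r. g $ k * (m ^ k) $ (r - i))" for i
    unfolding fps_compose_nth
    by (rule sum.mono_neutral_left) (auto simp: startsby_zero_power_prefix assms)
  hence "(b * (g oo m)) $ r = (\<Sum>i=0..r. \<Sum>k=0..r. g $ k * (b $ i * (m ^ k) $ (r - i)))"
    by (simp add: fps_mult_nth sum_distrib_left mult_ac)
  also have "\<dots> = (\<Sum>k=0..r. g $ k * (b * m ^ k) $ r)"
    by (subst sum.swap) (simp add: fps_mult_nth sum_distrib_left)
  finally show ?thesis .
qed

lemma one_minus_pow_mult_moebius_arg_power_nth:
  assumes "k \<le> r"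
  shows "(one_minus_pow (of_nat r - 1) * moebius_arg ^ k) $ r = (if k = r then (- 1) ^ r else 0)"
proof -
  have "one_minus_pow (of_nat r - 1) * moebius_arg ^ k =
      fps_const ((- 1) ^ k) * (fps_X ^ k * one_minus_pow (of_nat r - 1 - of_nat k))"
    using one_minus_pow_add[of "of_nat r - 1" "- of_nat k"]
    by (simp add: moebius_arg_power mult_ac)
  hence eq: "(one_minus_pow (of_nat r - 1) * moebius_arg ^ k) $ r =
      (- 1) ^ k * one_minus_pow (of_nat r - 1 - of_nat k) $ (r - k)"
    using assms by (simp add: fps_X_power_mult_nth)
  show ?thesis
  proof (cases "k = r")
    case True
    thus ?thesis unfolding eq by (simp add: one_minus_pow_def)
  next
    case False
    \<comment> \<open>For k < r the exponent is a natural number, and the binomial coefficient has a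
      lower entry exceeding its upper entry by one.\<close>
    with assms have "of_nat r - 1 - of_nat k = (of_nat (r - 1 - k) :: complex)"
      by (simp add: of_nat_diff)
    hence "(of_nat r - 1 - of_nat k :: complex) gchoose (r - k) = of_nat ((r - 1 - k) choose (r - k))"
      by (simp only: binomial_gbinomial)
    also have "(r - 1 - k) choose (r - k) = 0"
      using assms False by (intro binomial_eq_0) auto
    finally show ?thesis
      unfolding eq using False by (simp add: one_minus_pow_def)
  qed
qed

lemma one_minus_pow_mult_compose_moebius_arg_nth:
  "(one_minus_pow (of_nat r - 1) * (g oo moebius_arg)) $ r = (- 1) ^ r * g $ r"
proof -
  have "(one_minus_pow (of_nat r - 1) * (g oo moebius_arg)) $ r =
      (\<Sum>k=0..r. if k = r then (- 1) ^ r * g $ r else 0)"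
    unfolding fps_mult_compose_nth[OF moebius_arg_nth_0]
    by (intro sum.cong refl) (simp add: one_minus_pow_mult_moebius_arg_power_nth)
  thus ?thesis by simp
qed

text \<open>Covariance trades F for (1 - z)^\<alpha> F(m), so both factors are evaluated at m. The
  choice of q in the theorem makes the exponent q + \<alpha> equal to r - 1, as the coefficient
  lemma above requires.\<close>

lemma moebius_op_mult_covariant:
  assumes "moebius_covariant \<alpha> F"
  shows "moebius_op q h * F = one_minus_pow (q + \<alpha>) * (h * F oo moebius_arg)"
proof -
  have "one_minus_pow (q + \<alpha>) * (h * F oo moebius_arg) =
      moebius_op q h * (one_minus_pow (- \<alpha>) * one_minus_pow \<alpha>) * F"
    using assms
    by (simp only: moebius_covariant_def moebius_op_def one_minus_pow_add mult_ac
          fps_compose_mult_distrib[OF moebius_arg_nth_0])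
  thus ?thesis by simp
qed

theorem proposition2p4:
  fixes \<alpha> q :: complex and r :: nat and F :: "complex fps"
  assumes q: "q = of_nat r - 1 - \<alpha>"
    and F: "moebius_covariant \<alpha> F"
  shows "(\<forall>h :: complex fps.
            coeff_functional r F h = (- 1) ^ r * coeff_functional r F (moebius_op q h))
         \<and> moebius_op q \<circ> moebius_op q = id"
proof (intro conjI allI)
  fix h :: "complex fps"
  have "q + \<alpha> = of_nat r - 1"
    using q by simp
  hence "coeff_functional r F (moebius_op q h) = (- 1) ^ r * (h * F) $ r"
    unfolding coeff_functional_def moebius_op_mult_covariant[OF F]
    by (simp only: one_minus_pow_mult_compose_moebius_arg_nth)
  thus "coeff_functional r F h = (- 1) ^ r * coeff_functional r F (moebius_op q h)"
    by (simp add: coeff_functional_def flip: mult.assoc power_mult_distrib)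
next
  show "moebius_op q \<circ> moebius_op q = id"
    by (simp add: fun_eq_iff moebius_op_involution)
qed

end
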